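(* Let $X$ and $Y$ be trivial quandles of (finite) orders $n$ and $m$, respectively. Let $\mathbf{k}$ be an integral domain with unity, having more than two elements, whose characteristic is coprime to both $n$ and $m$, and such that none of $n$, $m$, $n+m$ is invertible in $\mathbf{k}$. Let $f\in\mathrm{Aut}(X)$ and $g\in\mathrm{Aut}(Y)$ be automorphisms acting transitively on $X$ and $Y$, respectively. Then $$\mathcal{I}\big(\mathbf{k}[X\sqcup_{f,g}Y]\big)=\mathcal{I}\big(\mathbf{k}[X]\big)\sqcup\mathcal{I}\big(\mathbf{k}[Y]\big)\sqcup\Big\{\alpha\Big(\sum_{x\in X}e_x\Big)+\beta\Big(\sum_{y\in Y}e_y\Big)\ \Big|\ \alpha,\beta\in\mathbf{k},\ \alpha n+\beta m=1\Big\}.$$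
   Context: A quandle is a non-empty set $X$ with a binary operation $*$ such that, for each $y\in X$, the map $x\mapsto x*y$ is an automorphism of $(X,* )$ fixing $y$. A quandle is trivial if $x*y=x$ for all $x,y$; the automorphism group of a trivial quandle is the permutation group of its underlying set. An automorphism $f$ acts transitively on $X$ if the cyclic group $\langle f\rangle$ acts transitively on $X$. For trivial quandles $X,Y$, $f\in\mathrm{Aut}(X)$ and $g\in\mathrm{Aut}(Y)$, $X\sqcup_{f,g}Y$ denotes the quandle on the disjoint union $X\sqcup Y$ in which $X$ and $Y$ are trivial subquandles and $x*y=f(x)$, $y*x=g(y)$ for $x\in X$, $y\in Y$. The quandle ring $\mathbf{k}[Z]$ of a quandle $Z$ is the free $\mathbf{k}$-module with basis $\{e_z\mid z\in Z\}$ with the (in general non-associative) $\mathbf{k}$-bilinear product determined by $e_ze_w=e_{z*w}$. $\mathcal{I}(\mathbf{k}[Z])$ denotes the set of idempotents, i.e. non-zero $u\in\mathbf{k}[Z]$ with $u^2=u$. The rings $\mathbf{k}[X]$ and $\mathbf{k}[Y]$ are viewed as subrings of $\mathbf{k}[X\sqcup_{f,g}Y]$. The condition that the characteristic of $\mathbf{k}$ is coprime to $n$ and $m$ is understood to mean that $n$ and $m$ are non-zero in $\mathbf{k}$ (automatic in characteristic $0$). *)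

theory Defs
  imports "HOL-Library.Poly_Mapping"
begin

record 'a quandle_struct =
  qset :: "'a set"
  qop :: "'a \<Rightarrow> 'a \<Rightarrow> 'a"

text \<open>Automorphisms are total functions of the ambient type; only their restriction
  to the underlying set matters.\<close>

definition quandle_aut :: "'a quandle_struct \<Rightarrow> ('a \<Rightarrow> 'a) \<Rightarrow> bool" where
  "quandle_aut X f \<longleftrightarrow> bij_betw f (qset X) (qset X) \<and>
     (\<forall>x\<in>qset X. \<forall>z\<in>qset X. f (qop X x z) = qop X (f x) (f z))"

definition quandle :: "'a quandle_struct \<Rightarrow> bool" where
  "quandle X \<longleftrightarrow> qset X \<noteq> {} \<and>
     (\<forall>y\<in>qset X. quandle_aut X (\<lambda>x. qop X x y) \<and> qop X y y = y)"

definition trivial_quandle :: "'a quandle_struct \<Rightarrow> bool" where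
  "trivial_quandle X \<longleftrightarrow> quandle X \<and> (\<forall>x\<in>qset X. \<forall>y\<in>qset X. qop X x y = x)"

text \<open>The \<open>k\<close>-th element of the cyclic group generated by a bijection \<open>f\<close> of \<open>A\<close>.\<close>

definition int_power_on :: "'a set \<Rightarrow> ('a \<Rightarrow> 'a) \<Rightarrow> int \<Rightarrow> 'a \<Rightarrow> 'a" where
  "int_power_on A f k =
     (if k \<ge> 0 then f ^^ nat k else inv_into A f ^^ nat (- k))"

definition acts_transitively :: "'a quandle_struct \<Rightarrow> ('a \<Rightarrow> 'a) \<Rightarrow> bool" where
  "acts_transitively X f \<longleftrightarrow>
     (\<forall>x\<in>qset X. \<forall>x'\<in>qset X. \<exists>k::int. int_power_on (qset X) f k x = x')"

fun join_op :: "'a quandle_struct \<Rightarrow> ('a \<Rightarrow> 'a) \<Rightarrow> ('b \<Rightarrow> 'b) \<Rightarrow> 'b quandle_struct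
    \<Rightarrow> 'a + 'b \<Rightarrow> 'a + 'b \<Rightarrow> 'a + 'b" where
  "join_op X f g Y (Inl x) (Inl x') = Inl (qop X x x')"
| "join_op X f g Y (Inl x) (Inr y) = Inl (f x)"
| "join_op X f g Y (Inr y) (Inl x) = Inr (g y)"
| "join_op X f g Y (Inr y) (Inr y') = Inr (qop Y y y')"

definition quandle_join :: "'a quandle_struct \<Rightarrow> ('a \<Rightarrow> 'a) \<Rightarrow> ('b \<Rightarrow> 'b) \<Rightarrow> 'b quandle_struct
    \<Rightarrow> ('a + 'b) quandle_struct" where
  "quandle_join X f g Y = \<lparr>qset = qset X <+> qset Y, qop = join_op X f g Y\<rparr>"

text \<open>Elements of \<open>k[Z]\<close> are the finitely supported functions with support in \<open>Z\<close>, and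
  \<open>e\<^sub>z\<close> is \<open>basis_elt z\<close>. The convolution product that \<open>Poly_Mapping\<close> puts on
  finitely supported functions over a monoid plays no role here.\<close>

definition qring_carrier :: "'z quandle_struct \<Rightarrow> ('z \<Rightarrow>\<^sub>0 'k::comm_ring_1) set" where
  "qring_carrier Z = {u. Poly_Mapping.keys u \<subseteq> qset Z}"

definition basis_elt :: "'z \<Rightarrow> ('z \<Rightarrow>\<^sub>0 'k::comm_ring_1)" where
  "basis_elt z = Poly_Mapping.single z 1"

definition qscale :: "'k::comm_ring_1 \<Rightarrow> ('z \<Rightarrow>\<^sub>0 'k) \<Rightarrow> ('z \<Rightarrow>\<^sub>0 'k)" where
  "qscale a u = Poly_Mapping.map ((*) a) u"

definition qring_mult :: "'z quandle_struct \<Rightarrow> ('z \<Rightarrow>\<^sub>0 'k::comm_ring_1) \<Rightarrow> ('z \<Rightarrow>\<^sub>0 'k) \<Rightarrow> ('z \<Rightarrow>\<^sub>0 'k)" where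
  "qring_mult Z u v =
     (\<Sum>z\<in>Poly_Mapping.keys u. \<Sum>w\<in>Poly_Mapping.keys v.
        qscale (Poly_Mapping.lookup u z * Poly_Mapping.lookup v w) (basis_elt (qop Z z w)))"

definition idempotents :: "'z quandle_struct \<Rightarrow> ('z \<Rightarrow>\<^sub>0 'k::comm_ring_1) set" where
  "idempotents Z = {u \<in> qring_carrier Z. u \<noteq> 0 \<and> qring_mult Z u u = u}"

text \<open>The linear map with \<open>e\<^sub>x \<mapsto> e\<^bsub>h x\<^esub>\<close>. For \<open>h = Inl\<close> and \<open>h = Inr\<close> this is the
  inclusion of \<open>k[X]\<close> and \<open>k[Y]\<close> into the quandle ring of the disjoint union.\<close>

definition qring_map :: "('x \<Rightarrow> 'z) \<Rightarrow> ('x \<Rightarrow>\<^sub>0 'k::comm_ring_1) \<Rightarrow> ('z \<Rightarrow>\<^sub>0 'k)" where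
  "qring_map h u =
     (\<Sum>x\<in>Poly_Mapping.keys u. qscale (Poly_Mapping.lookup u x) (basis_elt (h x)))"

lemma quandle_quandle_join:
  assumes "trivial_quandle X" "trivial_quandle Y" "quandle_aut X f" "quandle_aut Y g"
  shows "quandle (quandle_join X f g Y)"
proof -
  let ?Z = "quandle_join X f g Y"
  have X0: "qset X \<noteq> {}"
    and X: "\<And>x y. x \<in> qset X \<Longrightarrow> y \<in> qset X \<Longrightarrow> qop X x y = x"
    and Y: "\<And>x y. x \<in> qset Y \<Longrightarrow> y \<in> qset Y \<Longrightarrow> qop Y x y = x"
    using assms by (simp_all add: trivial_quandle_def quandle_def)
  have f: "bij_betw f (qset X) (qset X)" and g: "bij_betw g (qset Y) (qset Y)"
    using assms by (simp_all add: quandle_aut_def)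
  have fm: "f x \<in> qset X" if "x \<in> qset X" for x
    using f that by (rule bij_betw_apply)
  have gm: "g y \<in> qset Y" if "y \<in> qset Y" for y
    using g that by (rule bij_betw_apply)
  have set: "qset ?Z = Inl ` qset X \<union> Inr ` qset Y"
    by (simp add: quandle_join_def Plus_def)
  have opX: "qop ?Z (Inl x) (Inl x') = Inl x" if "x \<in> qset X" "x' \<in> qset X" for x x'
    using that X by (simp add: quandle_join_def)
  have opY: "qop ?Z (Inr y) (Inr y') = Inr y" if "y \<in> qset Y" "y' \<in> qset Y" for y y'
    using that Y by (simp add: quandle_join_def)
  have opXY: "qop ?Z (Inl x) (Inr y) = Inl (f x)" "qop ?Z (Inr y) (Inl x) = Inr (g y)" for x y
    by (simp_all add: quandle_join_def)
  have bij: "bij_betw (\<lambda>u. qop ?Z u z) (qset ?Z) (qset ?Z)"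
    if h: "bij_betw h (qset X) (qset X)" "\<And>x. x \<in> qset X \<Longrightarrow> qop ?Z (Inl x) z = Inl (h x)"
      and k: "bij_betw k (qset Y) (qset Y)" "\<And>y. y \<in> qset Y \<Longrightarrow> qop ?Z (Inr y) z = Inr (k y)"
    for z h k
  proof -
    have "bij_betw (\<lambda>u. qop ?Z u z) (Inl ` qset X) (Inl ` qset X)"
    proof -
      have "bij_betw (\<lambda>u. qop ?Z u z) (Inl ` qset X) (Inl ` h ` qset X)"
        unfolding bij_betw_def using h(1) 
        by (auto simp: inj_on_def h(2) image_image bij_betw_def cong: image_cong)
      then show ?thesis using h(1) by (simp add: bij_betw_def)
    qed
    moreover have "bij_betw (\<lambda>u. qop ?Z u z) (Inr ` qset Y) (Inr ` qset Y)"
    proof -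
      have "bij_betw (\<lambda>u. qop ?Z u z) (Inr ` qset Y) (Inr ` k ` qset Y)"
        unfolding bij_betw_def using k(1) 
        by (auto simp: inj_on_def k(2) image_image bij_betw_def cong: image_cong)
      then show ?thesis using k(1) by (simp add: bij_betw_def)
    qed
    moreover have "Inl ` qset X \<inter> Inr ` qset Y = {}" by blast
    ultimately show ?thesis unfolding set by (rule bij_betw_combine)
  qed
  have id: "bij_betw (\<lambda>x. x) A A" for A :: "'c set"
    by (simp add: bij_betw_def)
  have "quandle_aut ?Z (\<lambda>u. qop ?Z u z) \<and> qop ?Z z z = z" if "z \<in> qset ?Z" for z
  proof (cases z)
    case (Inl a)
    with that have a: "a \<in> qset X" by (auto simp: set)
    have "bij_betw (\<lambda>u. qop ?Z u z) (qset ?Z) (qset ?Z)"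
      by (rule bij[OF id _ g]) (simp_all add: Inl a opX opXY)
    then show ?thesis using a Inl
      by (auto simp: quandle_aut_def set opX opY opXY fm gm)
  next
    case (Inr b)
    with that have b: "b \<in> qset Y" by (auto simp: set)
    have "bij_betw (\<lambda>u. qop ?Z u z) (qset ?Z) (qset ?Z)"
      by (rule bij[OF f _ id]) (simp_all add: Inr b opY opXY)
    then show ?thesis using b Inr
      by (auto simp: quandle_aut_def set opX opY opXY fm gm)
  qed
  then show ?thesis
    using X0 by (auto simp: quandle_def set)
qed

lemma lookup_qscale [simp]: "Poly_Mapping.lookup (qscale a u) z = a * Poly_Mapping.lookup u z"
  by (simp add: qscale_def Poly_Mapping.map.rep_eq when_def)

lemma qring_mult_basis:
  "qring_mult Z (basis_elt z) (basis_elt w) = (basis_elt (qop Z z w) :: 'z \<Rightarrow>\<^sub>0 'k::comm_ring_1)"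
proof -
  have "qscale 1 u = u" for u :: "'z \<Rightarrow>\<^sub>0 'k"
    by (intro poly_mapping_eqI) simp
  then show ?thesis
    by (simp add: qring_mult_def basis_elt_def)
qed

lemma lookup_qring_map:
  assumes "inj h"
  shows "Poly_Mapping.lookup (qring_map h u) (h x) = Poly_Mapping.lookup u x"
proof -
  have "Poly_Mapping.lookup (qring_map h u) (h x) =
      (\<Sum>y\<in>Poly_Mapping.keys u. if y = x then Poly_Mapping.lookup u y else 0)"
    unfolding qring_map_def lookup_sum basis_elt_def
    using assms by (intro sum.cong) (auto simp: lookup_single when_def inj_eq)
  also have "\<dots> = Poly_Mapping.lookup u x"
    by (simp add: in_keys_iff)
  finally show ?thesis .
qed

end

theory Submission
  imports Defs
begin

text \<open>Write \<open>A\<close> and \<open>B\<close> for the sums of the coefficients \<open>a x\<close> and \<open>b y\<close> of \<open>u\<close> over \<open>X\<close> and \<open>Y\<close>.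
  Then \<open>u\<^sup>2 = u\<close> says that \<open>a (f x) = A a (f x) + B a x\<close> and \<open>b (g y) = B b (g y) + A b y\<close>.
  Summing gives \<open>A (A + B) = A\<close> and \<open>B (A + B) = B\<close>, so \<open>A + B = 1\<close> unless \<open>u = 0\<close>, and the
  equations become \<open>B (a (f x) - a x) = 0\<close> and \<open>A (b (g y) - b y) = 0\<close>. If \<open>A\<close> and \<open>B\<close> are
  non-zero, transitivity makes \<open>a\<close> and \<open>b\<close> constant. If \<open>B = 0\<close>, then \<open>b\<close> is a constant
  \<open>\<beta>\<close> with \<open>m \<beta> = 0\<close>, so \<open>u\<close> lies in \<open>k[X]\<close> and has coefficient sum \<open>1\<close>; the case \<open>A = 0\<close> is
  symmetric. A common element of \<open>k[X]\<close> and the mixed family would have \<open>\<beta> = 0\<close> and \<open>\<alpha> n = 1\<close>.\<close>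

section \<open>Coefficients and supports in quandle rings\<close>

lemma lookup_basis_elt:
  "Poly_Mapping.lookup (basis_elt z) t = (if z = t then 1 else 0)"
  by (simp add: basis_elt_def lookup_single when_def)

text \<open>The terms added outside the two supports vanish. Enlarging the index set to a common
  finite \<open>S\<close> lets later computations sum over all of \<open>qset X\<close> and
  \<open>qset Y\<close>, independently of the element.\<close>

lemma lookup_qring_mult:
  assumes "finite S" "Poly_Mapping.keys u \<subseteq> S" "Poly_Mapping.keys v \<subseteq> S"
  shows "Poly_Mapping.lookup (qring_mult Z u v) t =
    (\<Sum>z\<in>S. \<Sum>w\<in>S. if qop Z z w = t
       then Poly_Mapping.lookup u z * Poly_Mapping.lookup v w else 0)"
proof -
  have "Poly_Mapping.lookup (qring_mult Z u v) t =
    (\<Sum>z\<in>Poly_Mapping.keys u. \<Sum>w\<in>Poly_Mapping.keys v. if qop Z z w = t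
       then Poly_Mapping.lookup u z * Poly_Mapping.lookup v w else 0)"
    by (auto simp: qring_mult_def lookup_sum lookup_basis_elt intro!: sum.cong)
  also have "\<dots> = (\<Sum>z\<in>Poly_Mapping.keys u. \<Sum>w\<in>S. if qop Z z w = t
       then Poly_Mapping.lookup u z * Poly_Mapping.lookup v w else 0)"
    using assms by (intro sum.cong refl sum.mono_neutral_left) (auto simp: in_keys_iff)
  also have "\<dots> = (\<Sum>z\<in>S. \<Sum>w\<in>S. if qop Z z w = t
       then Poly_Mapping.lookup u z * Poly_Mapping.lookup v w else 0)"
    using assms by (intro sum.mono_neutral_left) (auto simp: in_keys_iff intro!: sum.neutral)
  finally show ?thesis .
qed

lemma trivial_quandleD:
  assumes "trivial_quandle X"
  shows "qset X \<noteq> {}" "\<And>x y. x \<in> qset X \<Longrightarrow> y \<in> qset X \<Longrightarrow> qop X x y = x"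
  using assms by (auto simp: trivial_quandle_def quandle_def)

text \<open>Right translations of a quandle map the underlying set to itself, so no basis element
  outside it can appear in a product. This supplies the support condition for comparing a square
  with its root in \<open>eq_iff_lookup_on\<close>.\<close>

lemma keys_qring_mult_subset:
  assumes "quandle Z" "Poly_Mapping.keys u \<subseteq> qset Z" "Poly_Mapping.keys v \<subseteq> qset Z"
  shows "Poly_Mapping.keys (qring_mult Z u v) \<subseteq> qset Z"
proof -
  have closed: "qop Z z w \<in> qset Z" if "z \<in> qset Z" "w \<in> qset Z" for z w
    using assms(1) that by (auto simp: quandle_def quandle_aut_def dest: bij_betw_apply)
  have "Poly_Mapping.lookup (qring_mult Z u v) t = 0" if "t \<notin> qset Z" for t
    unfolding qring_mult_def lookup_sum
    using assms(2,3) closed that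
    by (intro sum.neutral ballI) (auto simp: lookup_basis_elt)
  then show ?thesis by (auto simp: in_keys_iff)
qed

lemma lookup_eq_0_of_keys:
  "Poly_Mapping.keys u \<subseteq> S \<Longrightarrow> t \<notin> S \<Longrightarrow> Poly_Mapping.lookup u t = 0"
  by (auto simp: in_keys_iff)

lemma eq_iff_lookup_on:
  assumes "Poly_Mapping.keys u \<subseteq> S" "Poly_Mapping.keys v \<subseteq> S"
  shows "u = v \<longleftrightarrow> (\<forall>t\<in>S. Poly_Mapping.lookup u t = Poly_Mapping.lookup v t)"
  using assms by (metis lookup_eq_0_of_keys poly_mapping_eqI)

section \<open>Idempotents over a trivial quandle and their embedded images\<close>

lemma idempotents_trivial_quandle:
  fixes X :: "'a quandle_struct"
  assumes X: "trivial_quandle X" "finite (qset X)"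
  shows "(idempotents X :: ('a \<Rightarrow>\<^sub>0 'k::idom) set) =
    {u. Poly_Mapping.keys u \<subseteq> qset X \<and> (\<Sum>x\<in>qset X. Poly_Mapping.lookup u x) = 1}"
proof -
  have "u \<noteq> 0 \<and> qring_mult X u u = u \<longleftrightarrow> (\<Sum>x\<in>qset X. Poly_Mapping.lookup u x) = 1"
    if u: "Poly_Mapping.keys u \<subseteq> qset X" for u :: "'a \<Rightarrow>\<^sub>0 'k"
  proof -
    let ?A = "\<Sum>x\<in>qset X. Poly_Mapping.lookup u x"
    \<comment> \<open>Every right factor \<open>w\<close> leaves \<open>z\<close> unchanged, so
      squaring multiplies \<open>u\<close> by its coefficient sum. In a domain a non-zero
      \<open>u\<close> is then idempotent exactly when this sum is 1.\<close>
    have "Poly_Mapping.lookup (qring_mult X u u) t = Poly_Mapping.lookup u t * ?A"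
      if "t \<in> qset X" for t
    proof -
      have "Poly_Mapping.lookup (qring_mult X u u) t =
        (\<Sum>z\<in>qset X. if z = t then Poly_Mapping.lookup u z * ?A else 0)"
        unfolding lookup_qring_mult[OF X(2) u u]
        by (rule sum.cong) (auto simp: trivial_quandleD(2)[OF X(1)] sum_distrib_left)
      then show ?thesis using X(2) that by simp
    qed
    moreover have "Poly_Mapping.keys (qring_mult X u u) \<subseteq> qset X"
      using X u by (intro keys_qring_mult_subset) (simp_all add: trivial_quandle_def)
    ultimately have "qring_mult X u u = u \<longleftrightarrow>
        (\<forall>t\<in>qset X. Poly_Mapping.lookup u t * ?A = Poly_Mapping.lookup u t)"
      using u by (subst eq_iff_lookup_on) auto
    moreover have "u = 0 \<longleftrightarrow> (\<forall>t\<in>qset X. Poly_Mapping.lookup u t = 0)"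
      using u by (subst eq_iff_lookup_on) auto
    ultimately show ?thesis by auto
  qed
  then show ?thesis by (auto simp: idempotents_def qring_carrier_def)
qed

lemma keys_qring_map:
  assumes "inj h"
  shows "Poly_Mapping.keys (qring_map h u) = h ` Poly_Mapping.keys u"
proof -
  have "Poly_Mapping.lookup (qring_map h u) t = 0" if "t \<notin> range h" for t
    using that by (auto simp: qring_map_def lookup_sum lookup_basis_elt intro!: sum.neutral)
  then have "Poly_Mapping.keys (qring_map h u) \<subseteq> range h"
    by (auto simp: in_keys_iff)
  then show ?thesis
    by (auto simp: in_keys_iff lookup_qring_map[OF assms])
qed

text \<open>The preimage is found by pulling the coefficients back along \<open>h\<close>.
  Restricting to the finite set \<open>S\<close> makes it a finite sum and loses nothing, since the
  support of \<open>u\<close> lies in the image of \<open>S\<close>.\<close>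

lemma qring_map_surj:
  assumes "inj h" "finite S" "Poly_Mapping.keys u \<subseteq> h ` S"
  obtains v where "Poly_Mapping.keys v \<subseteq> S" "qring_map h v = u"
proof -
  define v where "v = (\<Sum>x\<in>S. Poly_Mapping.single x (Poly_Mapping.lookup u (h x)))"
  have v: "Poly_Mapping.lookup v x = (if x \<in> S then Poly_Mapping.lookup u (h x) else 0)" for x
    using assms(2) by (auto simp: v_def lookup_sum lookup_single when_def)
  have keys: "Poly_Mapping.keys v \<subseteq> S"
    by (auto simp: in_keys_iff v split: if_splits)
  moreover have "qring_map h v = u"
    using assms keys
    by (subst eq_iff_lookup_on[where S = "h ` S"]) (auto simp: keys_qring_map lookup_qring_map v)
  ultimately show ?thesis using that by blast
qed

text \<open>With \<open>h\<close> equal to \<open>Inl\<close> or \<open>Inr\<close>, this decides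
  membership in the embedded families by support and coefficient sum inside the large ring, so that
  preimages need not be handled in the main proof.\<close>

lemma qring_map_idempotents_trivial_quandle:
  fixes X :: "'a quandle_struct" and h :: "'a \<Rightarrow> 'z"
  assumes X: "trivial_quandle X" "finite (qset X)" and h: "inj h"
  shows "qring_map h ` (idempotents X :: ('a \<Rightarrow>\<^sub>0 'k::idom) set) =
    {u. Poly_Mapping.keys u \<subseteq> h ` qset X \<and> (\<Sum>x\<in>qset X. Poly_Mapping.lookup u (h x)) = 1}"
    (is "_ = ?R")
proof (intro set_eqI iffI)
  fix u :: "'z \<Rightarrow>\<^sub>0 'k" assume "u \<in> ?R"
  moreover from this obtain v where "Poly_Mapping.keys v \<subseteq> qset X" "qring_map h v = u"
    using qring_map_surj[OF h X(2)] by blast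
  ultimately show "u \<in> qring_map h ` idempotents X"
    using lookup_qring_map[OF h, of v] by (auto simp: idempotents_trivial_quandle[OF X])
qed (auto simp: idempotents_trivial_quandle[OF X] keys_qring_map[OF h] lookup_qring_map[OF h]
      intro!: imageI dest: subsetD)

section \<open>Functions invariant under a transitive automorphism\<close>

lemma invariant_imp_constant:
  assumes f: "bij_betw f (qset X) (qset X)" and trans: "acts_transitively X f"
    and inv: "\<And>x. x \<in> qset X \<Longrightarrow> c (f x) = c x"
    and x: "x \<in> qset X" and x': "x' \<in> qset X"
  shows "c x = c x'"
proof -
  have pow: "(h ^^ i) x \<in> qset X \<and> c ((h ^^ i) x) = c x"
    if "\<And>z. z \<in> qset X \<Longrightarrow> h z \<in> qset X" "\<And>z. z \<in> qset X \<Longrightarrow> c (h z) = c z" for h i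
    using that x by (induction i) auto
  \<comment> \<open>Negative exponents in \<open>int_power_on\<close> are powers of the inverse, so
    invariance must hold for it too: apply the invariance under \<open>f\<close> at the preimage of
    \<open>z\<close>.\<close>
  have inv_step: "inv_into (qset X) f z \<in> qset X \<and> c (inv_into (qset X) f z) = c z"
    if "z \<in> qset X" for z
    using f inv[of "inv_into (qset X) f z"] that
    by (simp add: bij_betw_def inv_into_into f_inv_into_f)
  obtain k where "int_power_on (qset X) f k x = x'"
    using trans x x' by (auto simp: acts_transitively_def)
  moreover have "c ((f ^^ nat k) x) = c x"
    using pow[of f] f inv by (auto dest: bij_betw_apply)
  moreover have "c ((inv_into (qset X) f ^^ nat (- k)) x) = c x"
    using pow[of "inv_into (qset X) f"] inv_step by auto
  ultimately show ?thesis by (auto simp: int_power_on_def split: if_splits)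
qed

section \<open>Products and idempotents in the ring of the join\<close>

lemma lookup_qring_mult_join:
  fixes X :: "'a quandle_struct" and Y :: "'b quandle_struct" and u v :: "'a + 'b \<Rightarrow>\<^sub>0 'k::comm_ring_1"
  defines "C \<equiv> \<Sum>x\<in>qset X. Poly_Mapping.lookup v (Inl x)"
    and "D \<equiv> \<Sum>y\<in>qset Y. Poly_Mapping.lookup v (Inr y)"
  assumes X: "trivial_quandle X" "finite (qset X)" and f: "bij_betw f (qset X) (qset X)"
    and Y: "trivial_quandle Y" "finite (qset Y)" and g: "bij_betw g (qset Y) (qset Y)"
    and u: "Poly_Mapping.keys u \<subseteq> qset X <+> qset Y"
    and v: "Poly_Mapping.keys v \<subseteq> qset X <+> qset Y"
  shows "x \<in> qset X \<Longrightarrow> Poly_Mapping.lookup (qring_mult (quandle_join X f g Y) u v) (Inl (f x)) =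
      Poly_Mapping.lookup u (Inl (f x)) * C + Poly_Mapping.lookup u (Inl x) * D"
    and "y \<in> qset Y \<Longrightarrow> Poly_Mapping.lookup (qring_mult (quandle_join X f g Y) u v) (Inr (g y)) =
      Poly_Mapping.lookup u (Inr (g y)) * D + Poly_Mapping.lookup u (Inr y) * C"
proof -
  let ?Z = "quandle_join X f g Y"
  have mult: "Poly_Mapping.lookup (qring_mult ?Z u v) t =
    (\<Sum>z\<in>qset X. (\<Sum>w\<in>qset X. if Inl z = t
        then Poly_Mapping.lookup u (Inl z) * Poly_Mapping.lookup v (Inl w) else 0)
      + (\<Sum>w\<in>qset Y. if Inl (f z) = t
        then Poly_Mapping.lookup u (Inl z) * Poly_Mapping.lookup v (Inr w) else 0))
    + (\<Sum>z\<in>qset Y. (\<Sum>w\<in>qset X. if Inr (g z) = t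
        then Poly_Mapping.lookup u (Inr z) * Poly_Mapping.lookup v (Inl w) else 0)
      + (\<Sum>w\<in>qset Y. if Inr z = t
        then Poly_Mapping.lookup u (Inr z) * Poly_Mapping.lookup v (Inr w) else 0))" for t
    unfolding lookup_qring_mult[OF finite_Plus[OF X(2) Y(2)] u v] sum.Plus[OF X(2) Y(2)]
    by (simp add: quandle_join_def trivial_quandleD(2)[OF X(1)] trivial_quandleD(2)[OF Y(1)]
        cong: sum.cong)
  {
    \<comment> \<open>Two left factors contribute at \<open>f x\<close>: the element
      \<open>f x\<close> itself, fixed by right factors from \<open>X\<close>, and \<open>x\<close>,
      sent there by right factors from \<open>Y\<close>. Reading the coefficient at
      \<open>f x\<close> avoids the inverse of \<open>f\<close>.\<close>
    assume x: "x \<in> qset X"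
    have fx: "f x \<in> qset X" and "\<And>z. z \<in> qset X \<Longrightarrow> f z = f x \<longleftrightarrow> z = x"
      using f x by (auto simp: bij_betw_def inj_on_eq_iff)
    then have "Poly_Mapping.lookup (qring_mult ?Z u v) (Inl (f x)) =
      (\<Sum>z\<in>qset X. (if z = f x then Poly_Mapping.lookup u (Inl z) * C else 0)
        + (if z = x then Poly_Mapping.lookup u (Inl z) * D else 0))"
      by (auto simp: mult C_def D_def sum_distrib_left intro!: sum.cong)
    then show "Poly_Mapping.lookup (qring_mult ?Z u v) (Inl (f x)) =
      Poly_Mapping.lookup u (Inl (f x)) * C + Poly_Mapping.lookup u (Inl x) * D"
      using X(2) x fx by (simp add: sum.distrib)
  }
  {
    assume y: "y \<in> qset Y"
    have gy: "g y \<in> qset Y" and "\<And>z. z \<in> qset Y \<Longrightarrow> g z = g y \<longleftrightarrow> z = y"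
      using g y by (auto simp: bij_betw_def inj_on_eq_iff)
    then have "Poly_Mapping.lookup (qring_mult ?Z u v) (Inr (g y)) =
      (\<Sum>z\<in>qset Y. (if z = g y then Poly_Mapping.lookup u (Inr z) * D else 0)
        + (if z = y then Poly_Mapping.lookup u (Inr z) * C else 0))"
      by (auto simp: mult C_def D_def sum_distrib_left intro!: sum.cong)
    then show "Poly_Mapping.lookup (qring_mult ?Z u v) (Inr (g y)) =
      Poly_Mapping.lookup u (Inr (g y)) * D + Poly_Mapping.lookup u (Inr y) * C"
      using Y(2) y gy by (simp add: sum.distrib)
  }
qed

text \<open>Since \<open>f\<close> and \<open>g\<close> are onto, it suffices to test points of the
  form \<open>f x\<close> and \<open>g y\<close>, the points at which
  \<open>lookup_qring_mult_join\<close> gives the coefficients.\<close>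

lemma ball_Plus_bij_betw:
  assumes "bij_betw f A A" "bij_betw g B B"
  shows "(\<forall>t\<in>A <+> B. P t) \<longleftrightarrow> (\<forall>x\<in>A. P (Inl (f x))) \<and> (\<forall>y\<in>B. P (Inr (g y)))"
proof -
  have "A <+> B = Inl ` f ` A \<union> Inr ` g ` B"
    using assms by (simp add: bij_betw_def Plus_def)
  then show ?thesis by auto
qed

text \<open>Each disjunction records a product that vanishes in the domain \<open>'k\<close>. The
  classification later splits on which of \<open>A\<close> and \<open>B\<close> is zero.\<close>

lemma mem_idempotents_join_iff:
  fixes X :: "'a quandle_struct" and Y :: "'b quandle_struct" and u :: "'a + 'b \<Rightarrow>\<^sub>0 'k::idom"
  defines "A \<equiv> \<Sum>x\<in>qset X. Poly_Mapping.lookup u (Inl x)"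
    and "B \<equiv> \<Sum>y\<in>qset Y. Poly_Mapping.lookup u (Inr y)"
  assumes X: "trivial_quandle X" "finite (qset X)" and f: "quandle_aut X f"
    and Y: "trivial_quandle Y" "finite (qset Y)" and g: "quandle_aut Y g"
  shows "u \<in> idempotents (quandle_join X f g Y) \<longleftrightarrow>
    Poly_Mapping.keys u \<subseteq> qset X <+> qset Y \<and> A + B = 1 \<and>
    (\<forall>x\<in>qset X. B = 0 \<or> Poly_Mapping.lookup u (Inl (f x)) = Poly_Mapping.lookup u (Inl x)) \<and>
    (\<forall>y\<in>qset Y. A = 0 \<or> Poly_Mapping.lookup u (Inr (g y)) = Poly_Mapping.lookup u (Inr y))"
    (is "?L \<longleftrightarrow> ?keys \<and> _ \<and> ?X \<and> ?Y")
proof (cases ?keys)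
  case u: True
  let ?Z = "quandle_join X f g Y"
  define a where "a = (\<lambda>x. Poly_Mapping.lookup u (Inl x))"
  define b where "b = (\<lambda>y. Poly_Mapping.lookup u (Inr y))"
  have A: "A = sum a (qset X)" and B: "B = sum b (qset Y)"
    by (simp_all add: A_def B_def a_def b_def)
  have qsetZ: "qset ?Z = qset X <+> qset Y" by (simp add: quandle_join_def)
  have bf: "bij_betw f (qset X) (qset X)" and bg: "bij_betw g (qset Y) (qset Y)"
    using f g by (simp_all add: quandle_aut_def)
  have keys: "Poly_Mapping.keys (qring_mult ?Z u u) \<subseteq> qset X <+> qset Y"
    using keys_qring_mult_subset[OF quandle_quandle_join[OF X(1) Y(1) f g]] u
    by (simp add: qsetZ)
  have sq: "qring_mult ?Z u u = u \<longleftrightarrow>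
      (\<forall>x\<in>qset X. a (f x) * A + a x * B = a (f x)) \<and>
      (\<forall>y\<in>qset Y. b (g y) * B + b y * A = b (g y))"
    unfolding eq_iff_lookup_on[OF keys u] ball_Plus_bij_betw[OF bf bg]
    using lookup_qring_mult_join[OF X bf Y bg u u]
    by (simp add: A_def B_def a_def b_def)
  have zero: "u = 0 \<longleftrightarrow> (\<forall>x\<in>qset X. a x = 0) \<and> (\<forall>y\<in>qset Y. b y = 0)"
    using u by (subst eq_iff_lookup_on) (auto simp: a_def b_def)
  have sumf: "(\<Sum>x\<in>qset X. a (f x)) = A" and sumg: "(\<Sum>y\<in>qset Y. b (g y)) = B"
    unfolding A B by (intro sum.reindex_bij_betw bf bg)+
  \<comment> \<open>Stated for general \<open>C\<close> and \<open>D\<close> because it serves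
    twice: with \<open>A\<close> and \<open>B\<close> for the equations over \<open>X\<close>, and
    with the two exchanged for those over \<open>Y\<close>.\<close>
  have eq_iff: "p * C + q * D = p \<longleftrightarrow> D = 0 \<or> p = q" if "C + D = 1" for p q C D :: 'k
  proof -
    have C: "C = 1 - D" using that by (simp add: eq_diff_eq)
    have "p * C + q * D - p = D * (q - p)" unfolding C by (simp add: algebra_simps)
    then show ?thesis by (metis eq_iff_diff_eq_0 mult_eq_0_iff)
  qed
  have red: "?L \<longleftrightarrow> u \<noteq> 0 \<and> qring_mult ?Z u u = u"
    using u by (simp add: idempotents_def qring_carrier_def qsetZ)
  have AB: "A + B = 1" if "u \<noteq> 0" "qring_mult ?Z u u = u"
  proof (rule ccontr)
    assume ne: "A + B \<noteq> 1"
    have "(\<Sum>x\<in>qset X. a (f x) * A + a x * B) = (\<Sum>x\<in>qset X. a (f x))"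
      using that(2) sq by (intro sum.cong) auto
    then have "A * A + A * B = A"
      by (simp add: sum.distrib sum_distrib_right[symmetric] sumf A[symmetric])
    then have "A * (A + B - 1) = 0" by (simp add: algebra_simps)
    with ne have "A = 0" by simp
    have "(\<Sum>y\<in>qset Y. b (g y) * B + b y * A) = (\<Sum>y\<in>qset Y. b (g y))"
      using that(2) sq by (intro sum.cong) auto
    then have "B * B + B * A = B"
      by (simp add: sum.distrib sum_distrib_right[symmetric] sumg B[symmetric])
    then have "B * (A + B - 1) = 0" by (simp add: algebra_simps)
    with ne have "B = 0" by simp
    \<comment> \<open>With both sums zero the left sides of the equations in \<open>sq\<close>
      vanish, so every coefficient at a point \<open>f x\<close> or \<open>g y\<close> is 0. These
      points exhaust \<open>X\<close> and \<open>Y\<close>, which contradicts \<open>u\<close> being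
      non-zero.\<close>
    have "\<forall>x\<in>f ` qset X. a x = 0" "\<forall>y\<in>g ` qset Y. b y = 0"
      using that(2) sq \<open>A = 0\<close> \<open>B = 0\<close> by simp_all
    with bf bg that(1) show False by (simp add: zero bij_betw_def)
  qed
  have "u \<noteq> 0" if "A + B = 1"
    using that by (auto simp: A_def B_def)
  moreover have "qring_mult ?Z u u = u \<longleftrightarrow> ?X \<and> ?Y" if "A + B = 1"
    unfolding sq using eq_iff[OF that] eq_iff[OF trans[OF add.commute that]]
    by (simp add: a_def b_def)
  ultimately show ?thesis using AB red u by blast
qed (auto simp: idempotents_def qring_carrier_def quandle_join_def)

section \<open>The mixed family and the classification\<close>

lemma lookup_mixed:
  fixes \<alpha> \<beta> :: "'k::comm_ring_1"
  assumes "finite S" "finite T"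
  shows "Poly_Mapping.lookup (qscale \<alpha> (\<Sum>x\<in>S. basis_elt (Inl x)) + qscale \<beta> (\<Sum>y\<in>T. basis_elt (Inr y)))
    t = (case t of Inl x \<Rightarrow> if x \<in> S then \<alpha> else 0 | Inr y \<Rightarrow> if y \<in> T then \<beta> else 0)"
  using assms by (simp add: lookup_add lookup_sum lookup_basis_elt split: sum.split)

theorem proposition6p3:
  fixes X :: "'a quandle_struct" and Y :: "'b quandle_struct"
    and f :: "'a \<Rightarrow> 'a" and g :: "'b \<Rightarrow> 'b"
    and n m :: nat
  assumes "trivial_quandle X" and "finite (qset X)" and "card (qset X) = n"
    and "trivial_quandle Y" and "finite (qset Y)" and "card (qset Y) = m"
    and "infinite (UNIV :: 'k::idom set) \<or> card (UNIV :: 'k set) > 2"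
    and "of_nat n \<noteq> (0 :: 'k)" and "of_nat m \<noteq> (0 :: 'k)"
    and "\<not> (of_nat n :: 'k) dvd 1"
    and "\<not> (of_nat m :: 'k) dvd 1"
    and "\<not> (of_nat (n + m) :: 'k) dvd 1"
    and "quandle_aut X f" and "acts_transitively X f"
    and "quandle_aut Y g" and "acts_transitively Y g"
  shows "let I_XY = (idempotents (quandle_join X f g Y) :: ('a + 'b \<Rightarrow>\<^sub>0 'k) set);
             I_X = qring_map Inl ` idempotents X;
             I_Y = qring_map Inr ` idempotents Y;
             I_mix = {qscale \<alpha> (\<Sum>x\<in>qset X. basis_elt (Inl x))
                      + qscale \<beta> (\<Sum>y\<in>qset Y. basis_elt (Inr y))
                      | \<alpha> \<beta>. \<alpha> * of_nat n + \<beta> * of_nat m = 1}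
         in I_XY = I_X \<union> I_Y \<union> I_mix \<and>
            I_X \<inter> I_Y = {} \<and> I_X \<inter> I_mix = {} \<and> I_Y \<inter> I_mix = {}"
proof -
  note X = assms(1,2) and Y = assms(4,5)
  have f: "bij_betw f (qset X) (qset X)" and g: "bij_betw g (qset Y) (qset Y)"
    using assms(13,15) by (simp_all add: quandle_aut_def)
  obtain x0 y0 where x0: "x0 \<in> qset X" and y0: "y0 \<in> qset Y"
    using trivial_quandleD(1)[OF X(1)] trivial_quandleD(1)[OF Y(1)] by blast
  define I_XY where "I_XY = (idempotents (quandle_join X f g Y) :: ('a + 'b \<Rightarrow>\<^sub>0 'k) set)"
  define I_X where "I_X = (qring_map Inl ` idempotents X :: ('a + 'b \<Rightarrow>\<^sub>0 'k) set)"
  define I_Y where "I_Y = (qring_map Inr ` idempotents Y :: ('a + 'b \<Rightarrow>\<^sub>0 'k) set)"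
  define mix where "mix \<alpha> \<beta> = qscale \<alpha> (\<Sum>x\<in>qset X. basis_elt (Inl x))
    + qscale \<beta> (\<Sum>y\<in>qset Y. basis_elt (Inr y))" for \<alpha> \<beta> :: 'k
  define I_mix where "I_mix = {mix \<alpha> \<beta> | \<alpha> \<beta>. \<alpha> * of_nat n + \<beta> * of_nat m = 1}"
  define A where "A u = (\<Sum>x\<in>qset X. Poly_Mapping.lookup u (Inl x))" for u :: "'a + 'b \<Rightarrow>\<^sub>0 'k"
  define B where "B u = (\<Sum>y\<in>qset Y. Poly_Mapping.lookup u (Inr y))" for u :: "'a + 'b \<Rightarrow>\<^sub>0 'k"
  have mix: "Poly_Mapping.lookup (mix \<alpha> \<beta>) t =
      (case t of Inl x \<Rightarrow> if x \<in> qset X then \<alpha> else 0 | Inr y \<Rightarrow> if y \<in> qset Y then \<beta> else 0)"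
    for \<alpha> \<beta> t
    unfolding mix_def by (rule lookup_mixed[OF X(2) Y(2)])
  have keys_mix: "Poly_Mapping.keys (mix \<alpha> \<beta>) \<subseteq> qset X <+> qset Y" for \<alpha> \<beta>
    by (auto simp: in_keys_iff mix split: sum.splits if_splits)
  have AB_mix: "A (mix \<alpha> \<beta>) = \<alpha> * of_nat n" "B (mix \<alpha> \<beta>) = \<beta> * of_nat m" for \<alpha> \<beta>
    using assms(3,6) by (simp_all add: A_def B_def mix mult.commute)
  have I_X: "u \<in> I_X \<longleftrightarrow> Poly_Mapping.keys u \<subseteq> Inl ` qset X \<and> A u = 1" for u
    by (simp add: I_X_def A_def qring_map_idempotents_trivial_quandle[OF X])
  have I_Y: "u \<in> I_Y \<longleftrightarrow> Poly_Mapping.keys u \<subseteq> Inr ` qset Y \<and> B u = 1" for u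
    by (simp add: I_Y_def B_def qring_map_idempotents_trivial_quandle[OF Y])
  have I_XY: "u \<in> I_XY \<longleftrightarrow> Poly_Mapping.keys u \<subseteq> qset X <+> qset Y \<and> A u + B u = 1 \<and>
    (\<forall>x\<in>qset X. B u = 0 \<or> Poly_Mapping.lookup u (Inl (f x)) = Poly_Mapping.lookup u (Inl x)) \<and>
    (\<forall>y\<in>qset Y. A u = 0 \<or> Poly_Mapping.lookup u (Inr (g y)) = Poly_Mapping.lookup u (Inr y))" for u
    unfolding I_XY_def A_def B_def by (rule mem_idempotents_join_iff[OF X assms(13) Y assms(15)])
  have Inr0: "Poly_Mapping.lookup u (Inr y) = 0" if "u \<in> I_X" for u y
    using that by (auto simp: I_X in_keys_iff)
  have Inl0: "Poly_Mapping.lookup u (Inl x) = 0" if "u \<in> I_Y" for u x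
    using that by (auto simp: I_Y in_keys_iff)
  have "I_X \<subseteq> I_XY"
  proof
    fix u assume u: "u \<in> I_X"
    \<comment> \<open>This settles the condition over \<open>X\<close> through its first
      alternative; the condition over \<open>Y\<close> compares coefficients that are both
      0.\<close>
    have "B u = 0" by (simp add: B_def Inr0[OF u])
    with u show "u \<in> I_XY" by (auto simp: I_XY Inr0[OF u]) (auto simp: I_X)
  qed
  moreover have "I_Y \<subseteq> I_XY"
  proof
    fix u assume u: "u \<in> I_Y"
    have "A u = 0" by (simp add: A_def Inl0[OF u])
    with u show "u \<in> I_XY" by (auto simp: I_XY Inl0[OF u]) (auto simp: I_Y)
  qed
  \<comment> \<open>Coefficients constant on \<open>X\<close> and on \<open>Y\<close> are invariant
    under \<open>f\<close> and \<open>g\<close>, and the relation between \<alpha> and \<beta> is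
    exactly \<open>A u + B u = 1\<close>.\<close>
  moreover have "I_mix \<subseteq> I_XY"
    using keys_mix f g by (auto simp: I_mix_def I_XY AB_mix mix dest: bij_betw_apply)
  moreover have "I_XY \<subseteq> I_X \<union> I_Y \<union> I_mix"
  proof
    fix u assume u: "u \<in> I_XY"
    then have keys: "Poly_Mapping.keys u \<subseteq> qset X <+> qset Y" and AB: "A u + B u = 1"
      by (simp_all add: I_XY)
    \<comment> \<open>The base points are arbitrary: by transitivity \<alpha> is the common
      coefficient on \<open>X\<close> when \<open>B u\<close> is non-zero, and \<beta> the one on
      \<open>Y\<close> when \<open>A u\<close> is non-zero.\<close>
    define \<alpha> where "\<alpha> = Poly_Mapping.lookup u (Inl x0)"
    define \<beta> where "\<beta> = Poly_Mapping.lookup u (Inr y0)"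
    have a: "Poly_Mapping.lookup u (Inl x) = \<alpha>" if "B u \<noteq> 0" "x \<in> qset X" for x
      unfolding \<alpha>_def using u that
      by (intro invariant_imp_constant[OF f assms(14) _ _ x0]) (auto simp: I_XY)
    have b: "Poly_Mapping.lookup u (Inr y) = \<beta>" if "A u \<noteq> 0" "y \<in> qset Y" for y
      unfolding \<beta>_def using u that
      by (intro invariant_imp_constant[OF g assms(16) _ _ y0]) (auto simp: I_XY)
    have A: "A u = \<alpha> * of_nat n" if "B u \<noteq> 0"
      using assms(3) a[OF that] by (simp add: A_def mult.commute)
    have B: "B u = \<beta> * of_nat m" if "A u \<noteq> 0"
      using assms(6) b[OF that] by (simp add: B_def mult.commute)
    consider "B u = 0" | "A u = 0" | "A u \<noteq> 0" "B u \<noteq> 0" by blast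
    then show "u \<in> I_X \<union> I_Y \<union> I_mix"
    proof cases
      case 1
      with AB have "A u = 1" by simp
      \<comment> \<open>Here \<open>B u = 0\<close> equals \<beta> times \<open>m\<close>, and
        \<open>m\<close> is non-zero in the domain. Hence all coefficients on \<open>Y\<close>
        vanish.\<close>
      with 1 B assms(9) have "\<beta> = 0" by simp
      with b \<open>A u = 1\<close> keys have "Poly_Mapping.keys u \<subseteq> Inl ` qset X"
        by (fastforce simp: in_keys_iff)
      with \<open>A u = 1\<close> show ?thesis by (simp add: I_X)
    next
      case 2
      with AB have "B u = 1" by simp
      with 2 A assms(8) have "\<alpha> = 0" by simp
      with a \<open>B u = 1\<close> keys have "Poly_Mapping.keys u \<subseteq> Inr ` qset Y"
        by (fastforce simp: in_keys_iff)
      with \<open>B u = 1\<close> show ?thesis by (simp add: I_Y)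
    next
      case 3
      then have "u = mix \<alpha> \<beta>"
        using a b by (subst eq_iff_lookup_on[OF keys keys_mix]) (auto simp: mix)
      moreover have "\<alpha> * of_nat n + \<beta> * of_nat m = 1"
        using 3 A B AB by simp
      ultimately show ?thesis by (auto simp: I_mix_def)
    qed
  qed
  moreover have "I_X \<inter> I_Y = {}"
  proof -
    \<comment> \<open>The functional \<open>A\<close> separates the two families, as it takes the
      value 1 on \<open>I_X\<close>.\<close>
    have "A u = 0" if "u \<in> I_Y" for u
      by (simp add: A_def Inl0[OF that])
    then show ?thesis by (auto simp: I_X)
  qed
  moreover have "I_X \<inter> I_mix = {}"
  proof -
    have False if "mix \<alpha> \<beta> \<in> I_X" for \<alpha> \<beta>
    proof -
      \<comment> \<open>Evaluating \<open>A\<close> in two ways, once as a member of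
        \<open>I_X\<close> and once as a mixed element, would make \<open>n\<close>
        invertible.\<close>
      have "\<alpha> * of_nat n = 1"
        using that by (simp add: I_X AB_mix)
      with assms(10) show False by (metis dvd_triv_right)
    qed
    then show ?thesis by (auto simp: I_mix_def)
  qed
  moreover have "I_Y \<inter> I_mix = {}"
  proof -
    have False if "mix \<alpha> \<beta> \<in> I_Y" for \<alpha> \<beta>
    proof -
      have "\<beta> * of_nat m = 1"
        using that by (simp add: I_Y AB_mix)
      with assms(11) show False by (metis dvd_triv_right)
    qed
    then show ?thesis by (auto simp: I_mix_def)
  qed
  ultimately show ?thesis
    unfolding Let_def I_XY_def[symmetric] I_X_def[symmetric] I_Y_def[symmetric]
      mix_def[symmetric] I_mix_def[symmetric]
    by blast
qed

end
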